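(* The infimum of the diameters of the slices of the closed unit ball of $B$, the predual of the James tree space $JT$, is at most $\sqrt2$; that is, $$\inf\{\operatorname{diam} S(B_{B},\varphi,\alpha): \varphi\in B^*,\ \alpha>0\}\le\sqrt2 ,$$ where $B_B$ is the closed unit ball of $B$.
   Context: All Banach spaces are real. For a Banach space $X$, $B_X$ is its closed unit ball and $X^*$ its topological dual; for bounded $A\subseteq X$, $\varphi\in X^*$ and $\alpha>0$, the slice is $S(A,\varphi,\alpha)=\{x\in A:\varphi(x)>\sup_{y\in A}\varphi(y)-\alpha\}$. The dyadic tree is $T=\{(n,i):0\le n<\infty,\ 0\le i<2^n\}$; the offspring of $(n,i)$ are $(n+1,2i)$ and $(n+1,2i+1)$. A segment is a non-empty finite set $\{t_1,\ldots,t_n\}$ such that $t_{j+1}$ is an offspring of $t_j$ for $1\le j\le n-1$. The James tree space $JT$ is the completion of the space of finitely nonzero functions $x:T\to\mathbb R$ under the norm $$\|x\|=\sup\Big(\sum_{i=1}^n\big(\sum_{t\in S_i}x(t)\big)^2\Big)^{1/2},$$ the supremum being over all finite families $\{S_1,\ldots,S_n\}$ of pairwise disjoint segments of $T$. For $t\in T$, $e_t^*\in JT^*$ is the coordinate functional determined by $e_t^*(x)=x(t)$ on finitely nonzero $x$. $B$ is the norm-closed linear span of $\{e_t^*:t\in T\}$ in $JT^*$; it is a predual of $JT$. *)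

theory Defs
  imports "HOL-Analysis.Analysis"
begin

definition dyadic_tree :: "(nat \<times> nat) set" where
  "dyadic_tree = {(n, i). i < 2 ^ n}"

definition offspring :: "nat \<times> nat \<Rightarrow> nat \<times> nat \<Rightarrow> bool" where
  "offspring s t \<longleftrightarrow> t = (fst s + 1, 2 * snd s) \<or> t = (fst s + 1, 2 * snd s + 1)"

definition segment :: "(nat \<times> nat) set \<Rightarrow> bool" where
  "segment S \<longleftrightarrow> (\<exists>ts. ts \<noteq> [] \<and> set ts \<subseteq> dyadic_tree \<and> successively offspring ts \<and> S = set ts)"

definition segment_family :: "(nat \<times> nat) set set \<Rightarrow> bool" where
  "segment_family F \<longleftrightarrow> finite F \<and> (\<forall>S\<in>F. segment S) \<and> disjoint F"

text \<open>A function on the tree is a function on all pairs that vanishes off the tree.\<close>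

definition finitely_nonzero :: "(nat \<times> nat \<Rightarrow> real) \<Rightarrow> bool" where
  "finitely_nonzero x \<longleftrightarrow> finite {t. x t \<noteq> 0} \<and> {t. x t \<noteq> 0} \<subseteq> dyadic_tree"

definition family_value :: "(nat \<times> nat) set set \<Rightarrow> (nat \<times> nat \<Rightarrow> real) \<Rightarrow> real" where
  "family_value F x = sqrt (\<Sum>S\<in>F. (\<Sum>t\<in>S. x t)\<^sup>2)"

definition jt_norm :: "(nat \<times> nat \<Rightarrow> real) \<Rightarrow> real" where
  "jt_norm x = (SUP F\<in>Collect segment_family. family_value F x)"

definition jt_bounded :: "(nat \<times> nat \<Rightarrow> real) \<Rightarrow> bool" where
  "jt_bounded x \<longleftrightarrow> (\<forall>t. t \<notin> dyadic_tree \<longrightarrow> x t = 0) \<and>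
     bdd_above ((\<lambda>F. family_value F x) ` Collect segment_family)"

lemma family_value_L2: "family_value F x = L2_set (sum x) F"
  by (simp add: family_value_def L2_set_def)

lemma segment_family_empty: "segment_family {}"
  by (simp add: segment_family_def)

lemma segment_singleton: "t \<in> dyadic_tree \<Longrightarrow> segment {t}"
  unfolding segment_def by (rule exI[of _ "[t]"]) simp

lemma family_value_nonneg: "0 \<le> family_value F x"
  by (simp add: family_value_L2 L2_set_nonneg)

lemma family_value_singleton: "family_value {{t}} x = \<bar>x t\<bar>"
  by (simp add: family_value_def)

lemma family_value_zero: "family_value F (\<lambda>_. 0) = 0"
  by (simp add: family_value_def)

lemma family_value_add: "family_value F (\<lambda>t. x t + y t) \<le> family_value F x + family_value F y"
  unfolding family_value_L2 using L2_set_triangle_ineq[of "sum x" "sum y" F]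
  by (simp add: sum.distrib[abs_def])

lemma family_value_scale: "family_value F (\<lambda>t. c * x t) = \<bar>c\<bar> * family_value F x"
  by (simp add: family_value_def sum_distrib_left[symmetric] power_mult_distrib real_sqrt_mult)

lemma family_value_minus: "family_value F (\<lambda>t. x t - y t) \<le> family_value F x + family_value F y"
  using family_value_add[of F x "\<lambda>t. (-1) * y t"] family_value_scale[of F "-1" y] by simp

lemma segment_family_singleton: "t \<in> dyadic_tree \<Longrightarrow> segment_family {{t}}"
  by (simp add: segment_family_def segment_singleton)

lemma family_value_le_norm:
  "jt_bounded x \<Longrightarrow> segment_family F \<Longrightarrow> family_value F x \<le> jt_norm x"
  unfolding jt_norm_def jt_bounded_def by (rule cSUP_upper) auto

lemma jt_norm_le:
  "(\<And>F. segment_family F \<Longrightarrow> family_value F x \<le> c) \<Longrightarrow> jt_norm x \<le> c"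
  unfolding jt_norm_def using segment_family_empty by (intro cSUP_least) auto

lemma jt_boundedI:
  assumes "\<And>t. t \<notin> dyadic_tree \<Longrightarrow> x t = 0"
    and "\<And>F. segment_family F \<Longrightarrow> family_value F x \<le> c"
  shows "jt_bounded x"
  unfolding jt_bounded_def using assms by (auto intro: bdd_aboveI[of _ c])

lemma jt_bounded_off: "jt_bounded x \<Longrightarrow> t \<notin> dyadic_tree \<Longrightarrow> x t = 0"
  unfolding jt_bounded_def by blast

lemma jt_norm_nonneg: "jt_bounded x \<Longrightarrow> 0 \<le> jt_norm x"
  using family_value_le_norm[OF _ segment_family_empty] family_value_nonneg by (metis order_trans)

lemma abs_le_jt_norm: "jt_bounded x \<Longrightarrow> \<bar>x t\<bar> \<le> jt_norm x"
proof (cases "t \<in> dyadic_tree")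
  case True
  assume "jt_bounded x"
  from family_value_le_norm[OF this segment_family_singleton[OF True]]
  show ?thesis by (simp add: family_value_singleton)
next
  case False
  assume "jt_bounded x"
  with False show ?thesis by (simp add: jt_bounded_off jt_norm_nonneg)
qed

lemma jt_bounded_add: "jt_bounded x \<Longrightarrow> jt_bounded y \<Longrightarrow> jt_bounded (\<lambda>t. x t + y t)"
  by (rule jt_boundedI[where c="jt_norm x + jt_norm y"])
    (auto simp: jt_bounded_off intro!: order_trans[OF family_value_add] add_mono family_value_le_norm)

lemma jt_bounded_scale: "jt_bounded x \<Longrightarrow> jt_bounded (\<lambda>t. c * x t)"
  by (rule jt_boundedI[where c="\<bar>c\<bar> * jt_norm x"])
    (auto simp: jt_bounded_off family_value_scale intro!: mult_left_mono family_value_le_norm)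

lemma jt_bounded_minus: "jt_bounded x \<Longrightarrow> jt_bounded y \<Longrightarrow> jt_bounded (\<lambda>t. x t - y t)"
  using jt_bounded_add[of x "\<lambda>t. (-1) * y t"] jt_bounded_scale[of y "-1"] by simp

lemma jt_norm_add:
  "jt_bounded x \<Longrightarrow> jt_bounded y \<Longrightarrow> jt_norm (\<lambda>t. x t + y t) \<le> jt_norm x + jt_norm y"
  by (rule jt_norm_le) (auto intro!: order_trans[OF family_value_add] add_mono family_value_le_norm)

lemma jt_norm_scale:
  assumes "jt_bounded x" shows "jt_norm (\<lambda>t. c * x t) = \<bar>c\<bar> * jt_norm x"
proof (rule antisym)
  have le: "jt_norm (\<lambda>t. c * x t) \<le> \<bar>c\<bar> * jt_norm x" if "jt_bounded x" for c x
    by (rule jt_norm_le) (auto simp: family_value_scale that intro!: mult_left_mono family_value_le_norm)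
  show "jt_norm (\<lambda>t. c * x t) \<le> \<bar>c\<bar> * jt_norm x" by (rule le[OF assms])
  show "\<bar>c\<bar> * jt_norm x \<le> jt_norm (\<lambda>t. c * x t)"
  proof (cases "c = 0")
    case True
    then show ?thesis using jt_norm_nonneg[OF jt_bounded_scale[OF assms, of c]] by simp
  next
    case False
    have "jt_norm (\<lambda>t. inverse c * (c * x t)) \<le> \<bar>inverse c\<bar> * jt_norm (\<lambda>t. c * x t)"
      by (rule le[OF jt_bounded_scale[OF assms]])
    then have "jt_norm x \<le> \<bar>inverse c\<bar> * jt_norm (\<lambda>t. c * x t)"
      using False by (simp add: mult.assoc[symmetric])
    then show ?thesis using False by (simp add: field_simps)
  qed
qed

lemma jt_norm_minus:
  "jt_bounded x \<Longrightarrow> jt_bounded y \<Longrightarrow> jt_norm (\<lambda>t. x t - y t) \<le> jt_norm x + jt_norm y"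
  by (rule jt_norm_le) (auto intro!: order_trans[OF family_value_minus] add_mono family_value_le_norm)

lemma finitely_nonzero_zero: "finitely_nonzero (\<lambda>_. 0)"
  by (simp add: finitely_nonzero_def)

lemma finitely_nonzero_add:
  assumes "finitely_nonzero x" "finitely_nonzero y"
  shows "finitely_nonzero (\<lambda>t. x t + y t)"
proof -
  have "{t. x t + y t \<noteq> 0} \<subseteq> {t. x t \<noteq> 0} \<union> {t. y t \<noteq> 0}" by auto
  then show ?thesis using assms unfolding finitely_nonzero_def
    by (auto intro: finite_subset[of _ "{t. x t \<noteq> 0} \<union> {t. y t \<noteq> 0}"])
qed

lemma finitely_nonzero_scale:
  assumes "finitely_nonzero x" shows "finitely_nonzero (\<lambda>t. c * x t)"
  using assms unfolding finitely_nonzero_def by (auto intro: rev_finite_subset)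

lemma finitely_nonzero_jt_bounded:
  assumes "finitely_nonzero x" shows "jt_bounded x"
proof (rule jt_boundedI)
  define D where "D = {t. x t \<noteq> 0}"
  have fin: "finite D" using assms by (simp add: D_def finitely_nonzero_def)
  show "x t = 0" if "t \<notin> dyadic_tree" for t
    using assms that by (auto simp: finitely_nonzero_def)
  fix F assume F: "segment_family F"
  have finS: "finite S" if "S \<in> F" for S
    using F that by (auto simp: segment_family_def segment_def)
  have "family_value F x \<le> (\<Sum>S\<in>F. \<bar>sum x S\<bar>)"
    unfolding family_value_L2 by (rule L2_set_le_sum_abs)
  also have "\<dots> \<le> (\<Sum>S\<in>F. \<Sum>t\<in>S. \<bar>x t\<bar>)"
    by (intro sum_mono sum_abs)
  also have "\<dots> = (\<Sum>t\<in>\<Union>F. \<bar>x t\<bar>)"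
    using F finS by (subst sum.Union_disjoint) (auto simp: segment_family_def disjoint_def)
  also have "\<dots> = (\<Sum>t\<in>\<Union>F \<inter> D. \<bar>x t\<bar>)"
    using F finS by (intro sum.mono_neutral_right) (auto simp: segment_family_def D_def)
  also have "\<dots> \<le> (\<Sum>t\<in>D. \<bar>x t\<bar>)"
    by (rule sum_mono2) (auto simp: fin)
  finally show "family_value F x \<le> (\<Sum>t\<in>D. \<bar>x t\<bar>)" .
qed

text \<open>The completion is realised as the closure of the finitely nonzero functions inside the
  (complete) space of all functions of finite norm; see the density lemma and the \<open>banach\<close>
  instance below.\<close>

typedef jt = "{x. jt_bounded x \<and> (\<forall>\<epsilon>>0. \<exists>y. finitely_nonzero y \<and> jt_norm (\<lambda>t. x t - y t) < \<epsilon>)}"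
  morphisms jt_fun Abs_jt
proof
  show "(\<lambda>_. 0) \<in> {x. jt_bounded x \<and> (\<forall>\<epsilon>>0. \<exists>y. finitely_nonzero y \<and> jt_norm (\<lambda>t. x t - y t) < \<epsilon>)}"
  proof (intro CollectI conjI allI impI exI)
    show "jt_bounded (\<lambda>_. 0)" by (rule finitely_nonzero_jt_bounded[OF finitely_nonzero_zero])
    show "jt_norm (\<lambda>t. 0 - 0) < \<epsilon>" if "\<epsilon> > 0" for \<epsilon> :: real
      using jt_norm_le[of "\<lambda>_. 0" 0] that by (simp add: family_value_zero)
  qed (rule finitely_nonzero_zero)
qed

setup_lifting type_definition_jt

lemma jt_bounded_jt_fun: "jt_bounded (jt_fun x)"
  using jt_fun[of x] by simp

lemma finitely_nonzero_in_jt: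
  assumes "finitely_nonzero x"
  shows "x \<in> {x. jt_bounded x \<and> (\<forall>\<epsilon>>0. \<exists>y. finitely_nonzero y \<and> jt_norm (\<lambda>t. x t - y t) < \<epsilon>)}"
proof (intro CollectI conjI allI impI exI)
  show "jt_bounded x" by (rule finitely_nonzero_jt_bounded[OF assms])
  show "finitely_nonzero x" by (rule assms)
  show "jt_norm (\<lambda>t. x t - x t) < \<epsilon>" if "\<epsilon> > 0" for \<epsilon> :: real
    using jt_norm_le[of "\<lambda>_. 0" 0] that by (simp add: family_value_zero)
qed

instantiation jt :: real_vector
begin

lift_definition zero_jt :: jt is "\<lambda>_. 0"
  using finitely_nonzero_in_jt[OF finitely_nonzero_zero] by simp

lift_definition plus_jt :: "jt \<Rightarrow> jt \<Rightarrow> jt" is "\<lambda>x y t. x t + y t"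
proof (intro conjI allI impI, goal_cases)
  case (1 x y)
  then show ?case by (simp add: jt_bounded_add)
next
  case (2 x y e)
  then obtain u v where uv: "finitely_nonzero u" "finitely_nonzero v"
    "jt_norm (\<lambda>t. x t - u t) < e / 2" "jt_norm (\<lambda>t. y t - v t) < e / 2"
    by (meson half_gt_zero)
  have "jt_norm (\<lambda>t. (x t - u t) + (y t - v t)) \<le> jt_norm (\<lambda>t. x t - u t) + jt_norm (\<lambda>t. y t - v t)"
    using 2 uv by (auto intro!: jt_norm_add jt_bounded_minus simp: finitely_nonzero_jt_bounded)
  also have "\<dots> < e" using uv by simp
  finally show ?case
    using uv by (intro exI[of _ "\<lambda>t. u t + v t"]) (auto simp: finitely_nonzero_add algebra_simps)
qed

lift_definition scaleR_jt :: "real \<Rightarrow> jt \<Rightarrow> jt" is "\<lambda>c x t. c * x t"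
proof (intro conjI allI impI, goal_cases)
  case (1 c x)
  then show ?case by (simp add: jt_bounded_scale)
next
  case (2 c x e)
  have pos: "e / (\<bar>c\<bar> + 1) > 0" using 2 by (simp add: add_nonneg_pos)
  then obtain u where u: "finitely_nonzero u" "jt_norm (\<lambda>t. x t - u t) < e / (\<bar>c\<bar> + 1)"
    using 2 by blast
  have b: "jt_bounded (\<lambda>t. x t - u t)"
    using 2 u by (auto intro!: jt_bounded_minus simp: finitely_nonzero_jt_bounded)
  have "jt_norm (\<lambda>t. c * (x t - u t)) = \<bar>c\<bar> * jt_norm (\<lambda>t. x t - u t)"
    by (rule jt_norm_scale[OF b])
  also have "\<dots> \<le> \<bar>c\<bar> * (e / (\<bar>c\<bar> + 1))" using u by (intro mult_left_mono) auto
  also have "\<dots> < e" using 2 by (simp add: field_simps add_nonneg_pos)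
  finally show ?case
    using u by (intro exI[of _ "\<lambda>t. c * u t"]) (auto simp: finitely_nonzero_scale algebra_simps)
qed

definition uminus_jt :: "jt \<Rightarrow> jt" where "uminus_jt x = (-1) *\<^sub>R x"

definition minus_jt :: "jt \<Rightarrow> jt \<Rightarrow> jt" where "minus_jt x y = x + (-1) *\<^sub>R y"

lemma jt_fun_zero: "jt_fun 0 t = 0" by transfer simp
lemma jt_fun_add: "jt_fun (x + y) t = jt_fun x t + jt_fun y t" by transfer simp
lemma jt_fun_scaleR: "jt_fun (c *\<^sub>R x) t = c * jt_fun x t" by transfer simp
lemma jt_fun_uminus: "jt_fun (- x) t = - jt_fun x t"
  by (simp add: uminus_jt_def jt_fun_scaleR)
lemma jt_fun_minus: "jt_fun (x - y) t = jt_fun x t - jt_fun y t"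
  by (simp add: minus_jt_def jt_fun_add jt_fun_scaleR)

instance
  by standard
    (simp_all add: jt_fun_inject[symmetric] fun_eq_iff jt_fun_zero jt_fun_add jt_fun_scaleR
      jt_fun_uminus jt_fun_minus algebra_simps)

end

instantiation jt :: real_normed_vector
begin

definition norm_jt :: "jt \<Rightarrow> real" where "norm_jt x = jt_norm (jt_fun x)"
definition dist_jt :: "jt \<Rightarrow> jt \<Rightarrow> real" where "dist_jt x y = norm (x - y)"
definition sgn_jt :: "jt \<Rightarrow> jt" where "sgn_jt x = x /\<^sub>R norm x"
definition uniformity_jt :: "(jt \<times> jt) filter" where
  "uniformity_jt = (INF e\<in>{0 <..}. principal {(x, y). dist x y < e})"
definition open_jt :: "jt set \<Rightarrow> bool" where
  "open_jt U = (\<forall>x\<in>U. eventually (\<lambda>(x', y). x' = x \<longrightarrow> y \<in> U) uniformity)"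

instance
proof
  fix x y :: jt and a :: real
  show "(norm x = 0) = (x = 0)"
  proof
    assume "norm x = 0"
    then have "jt_fun x t = 0" for t
      using abs_le_jt_norm[OF jt_bounded_jt_fun, of x t] by (simp add: norm_jt_def)
    then show "x = 0" by transfer auto
  next
    assume "x = 0"
    then have "jt_fun x = (\<lambda>_. 0)" by (simp add: fun_eq_iff jt_fun_zero)
    then show "norm x = 0"
      using jt_norm_le[of "jt_fun x" 0] jt_norm_nonneg[OF jt_bounded_jt_fun[of x]]
      by (simp add: norm_jt_def family_value_zero)
  qed
  have "jt_fun (x + y) = (\<lambda>t. jt_fun x t + jt_fun y t)" by (simp add: fun_eq_iff jt_fun_add)
  then show "norm (x + y) \<le> norm x + norm y"
    by (simp add: norm_jt_def jt_norm_add jt_bounded_jt_fun)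
  have "jt_fun (a *\<^sub>R x) = (\<lambda>t. a * jt_fun x t)" by (simp add: fun_eq_iff jt_fun_scaleR)
  then show "norm (a *\<^sub>R x) = \<bar>a\<bar> * norm x"
    by (simp add: norm_jt_def jt_norm_scale jt_bounded_jt_fun)
qed (simp_all only: dist_jt_def sgn_jt_def uniformity_jt_def open_jt_def)

end

lemma abs_jt_fun_le: "\<bar>jt_fun x t\<bar> \<le> norm x"
  unfolding norm_jt_def by (rule abs_le_jt_norm[OF jt_bounded_jt_fun])

lemma jt_fun_Abs_finitely_nonzero: "finitely_nonzero x \<Longrightarrow> jt_fun (Abs_jt x) = x"
  by (rule Abs_jt_inverse[OF finitely_nonzero_in_jt])

lemma finitely_nonzero_dense: "closure {x :: jt. finitely_nonzero (jt_fun x)} = UNIV"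
proof (rule equalityI[OF subset_UNIV], rule subsetI)
  fix x :: jt
  show "x \<in> closure {x. finitely_nonzero (jt_fun x)}"
    unfolding closure_approachable
  proof (intro allI impI)
    fix e :: real assume "e > 0"
    then obtain y where y: "finitely_nonzero y" "jt_norm (\<lambda>t. jt_fun x t - y t) < e"
      using jt_fun[of x] by auto
    have "jt_fun (x - Abs_jt y) = (\<lambda>t. jt_fun x t - y t)"
      by (simp add: fun_eq_iff jt_fun_minus jt_fun_Abs_finitely_nonzero[OF y(1)])
    with y show "\<exists>y\<in>{x. finitely_nonzero (jt_fun x)}. dist y x < e"
      by (intro bexI[of _ "Abs_jt y"])
        (auto simp: dist_commute dist_norm norm_jt_def jt_fun_Abs_finitely_nonzero)
  qed
qed

instance jt :: banach
proof
  fix X :: "nat \<Rightarrow> jt" assume X: "Cauchy X"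
  have "Cauchy (\<lambda>n. jt_fun (X n) t)" for t
  proof (rule metric_CauchyI)
    fix e :: real assume "e > 0"
    with X obtain M where M: "\<And>m n. m \<ge> M \<Longrightarrow> n \<ge> M \<Longrightarrow> dist (X m) (X n) < e"
      unfolding Cauchy_def by blast
    show "\<exists>M. \<forall>m\<ge>M. \<forall>n\<ge>M. dist (jt_fun (X m) t) (jt_fun (X n) t) < e"
    proof (intro exI[of _ M] allI impI)
      fix m n assume "m \<ge> M" "n \<ge> M"
      then show "dist (jt_fun (X m) t) (jt_fun (X n) t) < e"
        using M[of m n] abs_jt_fun_le[of "X m - X n" t] by (simp add: dist_norm jt_fun_minus)
    qed
  qed
  then have "convergent (\<lambda>n. jt_fun (X n) t)" for t
    by (rule Cauchy_convergent)
  moreover define x where "x t = lim (\<lambda>n. jt_fun (X n) t)" for t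
  ultimately have x: "(\<lambda>n. jt_fun (X n) t) \<longlonglongrightarrow> x t" for t
    by (simp add: convergent_LIMSEQ_iff)
  have key: "\<exists>M. \<forall>n\<ge>M. \<forall>F. segment_family F \<longrightarrow> family_value F (\<lambda>t. x t - jt_fun (X n) t) \<le> e"
    if "e > 0" for e
  proof -
    from X that obtain M where M: "\<And>m n. m \<ge> M \<Longrightarrow> n \<ge> M \<Longrightarrow> dist (X m) (X n) < e"
      unfolding Cauchy_def by blast
    show ?thesis
    proof (intro exI[of _ M] allI impI)
      fix n F assume n: "n \<ge> M" and F: "segment_family F"
      have "(\<lambda>m. family_value F (\<lambda>t. jt_fun (X m) t - jt_fun (X n) t))
          \<longlonglongrightarrow> family_value F (\<lambda>t. x t - jt_fun (X n) t)"
        unfolding family_value_def by (intro tendsto_intros x)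
      moreover have "family_value F (\<lambda>t. jt_fun (X m) t - jt_fun (X n) t) \<le> e" if "m \<ge> M" for m
      proof -
        have "family_value F (jt_fun (X m - X n)) \<le> norm (X m - X n)"
          unfolding norm_jt_def by (rule family_value_le_norm[OF jt_bounded_jt_fun F])
        moreover have "jt_fun (X m - X n) = (\<lambda>t. jt_fun (X m) t - jt_fun (X n) t)"
          by (simp add: fun_eq_iff jt_fun_minus)
        ultimately show ?thesis using M[OF that n] by (simp add: dist_norm)
      qed
      ultimately show "family_value F (\<lambda>t. x t - jt_fun (X n) t) \<le> e"
        by (intro LIMSEQ_le_const2) auto
    qed
  qed
  have off: "x t = 0" if "t \<notin> dyadic_tree" for t
    using x[of t] that by (simp add: jt_bounded_off[OF jt_bounded_jt_fun] LIMSEQ_const_iff)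
  have bd: "jt_bounded x"
  proof -
    from key[of 1] obtain M where
      M: "\<And>F. segment_family F \<Longrightarrow> family_value F (\<lambda>t. x t - jt_fun (X M) t) \<le> 1" by auto
    have "jt_bounded (\<lambda>t. x t - jt_fun (X M) t)"
      using M off by (intro jt_boundedI[where c=1]) (auto simp: jt_bounded_off[OF jt_bounded_jt_fun])
    from jt_bounded_add[OF this jt_bounded_jt_fun[of "X M"]] show ?thesis by simp
  qed
  have lim: "\<exists>M. \<forall>n\<ge>M. jt_norm (\<lambda>t. x t - jt_fun (X n) t) \<le> e" if "e > 0" for e
    using key[OF that] by (meson jt_norm_le)
  have mem: "x \<in> {x. jt_bounded x \<and> (\<forall>\<epsilon>>0. \<exists>y. finitely_nonzero y \<and> jt_norm (\<lambda>t. x t - y t) < \<epsilon>)}"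
  proof (intro CollectI conjI allI impI bd)
    fix e :: real assume e: "e > 0"
    then obtain n where n: "jt_norm (\<lambda>t. x t - jt_fun (X n) t) \<le> e / 2"
      using lim[of "e / 2"] by auto
    obtain y where y: "finitely_nonzero y" "jt_norm (\<lambda>t. jt_fun (X n) t - y t) < e / 2"
      using jt_fun[of "X n"] e by (auto dest: spec[of _ "e / 2"])
    have "jt_norm (\<lambda>t. (x t - jt_fun (X n) t) + (jt_fun (X n) t - y t))
        \<le> jt_norm (\<lambda>t. x t - jt_fun (X n) t) + jt_norm (\<lambda>t. jt_fun (X n) t - y t)"
      by (intro jt_norm_add jt_bounded_minus bd jt_bounded_jt_fun finitely_nonzero_jt_bounded y)
    with n y show "\<exists>y. finitely_nonzero y \<and> jt_norm (\<lambda>t. x t - y t) < e"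
      by (intro exI[of _ y]) auto
  qed
  have "X \<longlonglongrightarrow> Abs_jt x"
  proof (rule metric_LIMSEQ_I)
    fix e :: real assume e: "e > 0"
    then obtain M where M: "\<And>n. n \<ge> M \<Longrightarrow> jt_norm (\<lambda>t. x t - jt_fun (X n) t) \<le> e / 2"
      using lim[of "e / 2"] by auto
    have "dist (X n) (Abs_jt x) < e" if "n \<ge> M" for n
    proof -
      have "jt_fun (Abs_jt x - X n) = (\<lambda>t. x t - jt_fun (X n) t)"
        by (simp add: fun_eq_iff jt_fun_minus Abs_jt_inverse[OF mem])
      then have "dist (Abs_jt x) (X n) \<le> e / 2" using M[OF that] by (simp add: dist_norm norm_jt_def)
      then show ?thesis using e by (simp add: dist_commute)
    qed
    then show "\<exists>M. \<forall>n\<ge>M. dist (X n) (Abs_jt x) < e" by blast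
  qed
  then show "convergent X" unfolding convergent_def by blast
qed

lift_definition jt_coord :: "nat \<times> nat \<Rightarrow> (jt \<Rightarrow>\<^sub>L real)" is "\<lambda>t x. jt_fun x t"
  by (rule bounded_linear_intro[where K=1])
    (simp_all add: jt_fun_add jt_fun_scaleR abs_jt_fun_le)

text \<open>The space \<open>B\<close> is made a type of its own, so that its dual \<open>B\<^sup>*\<close> is
  the type \<open>jt_predual \<Rightarrow>\<^sub>L real\<close>.\<close>

typedef jt_predual = "closure (span (jt_coord ` dyadic_tree))"
  morphisms jt_functional Abs_jt_predual
  using closure_subset span_zero by blast

lemma subspace_closure:
  fixes S :: "'a::real_normed_vector set"
  assumes "subspace S" shows "subspace (closure S)"
proof (rule subspaceI)
  show "0 \<in> closure S" using subspace_0[OF assms] closure_subset by blast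
next
  fix x y assume "x \<in> closure S" "y \<in> closure S"
  then obtain f g where fg: "\<And>n. f n \<in> S" "f \<longlonglongrightarrow> x" "\<And>n. g n \<in> S" "g \<longlonglongrightarrow> y"
    unfolding closure_sequential by auto
  then have "(\<lambda>n. f n + g n) \<longlonglongrightarrow> x + y" "\<And>n. f n + g n \<in> S"
    by (auto intro: tendsto_add subspace_add[OF assms])
  then show "x + y \<in> closure S"
    unfolding closure_sequential by (intro exI[of _ "\<lambda>n. f n + g n"]) simp
next
  fix c x assume "x \<in> closure S"
  then obtain f where f: "\<And>n. f n \<in> S" "f \<longlonglongrightarrow> x"
    unfolding closure_sequential by auto
  then have "(\<lambda>n. c *\<^sub>R f n) \<longlonglongrightarrow> c *\<^sub>R x" "\<And>n. c *\<^sub>R f n \<in> S"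
    by (auto intro: tendsto_scaleR subspace_scale[OF assms])
  then show "c *\<^sub>R x \<in> closure S"
    unfolding closure_sequential by (intro exI[of _ "\<lambda>n. c *\<^sub>R f n"]) simp
qed

lemma subspace_jt_predual: "subspace (closure (span (jt_coord ` dyadic_tree)))"
  by (intro subspace_closure subspace_span)

setup_lifting type_definition_jt_predual

instantiation jt_predual :: real_vector
begin

lift_definition zero_jt_predual :: jt_predual is 0
  by (rule subspace_0[OF subspace_jt_predual])
lift_definition plus_jt_predual :: "jt_predual \<Rightarrow> jt_predual \<Rightarrow> jt_predual" is "(+)"
  by (rule subspace_add[OF subspace_jt_predual])
lift_definition minus_jt_predual :: "jt_predual \<Rightarrow> jt_predual \<Rightarrow> jt_predual" is "(-)"
  by (rule subspace_diff[OF subspace_jt_predual])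
lift_definition uminus_jt_predual :: "jt_predual \<Rightarrow> jt_predual" is uminus
  by (rule subspace_neg[OF subspace_jt_predual])
lift_definition scaleR_jt_predual :: "real \<Rightarrow> jt_predual \<Rightarrow> jt_predual" is "(*\<^sub>R)"
  by (rule subspace_scale[OF subspace_jt_predual])

instance
  by standard (transfer, simp add: algebra_simps)+

end

instantiation jt_predual :: real_normed_vector
begin

lift_definition norm_jt_predual :: "jt_predual \<Rightarrow> real" is norm .
definition dist_jt_predual :: "jt_predual \<Rightarrow> jt_predual \<Rightarrow> real" where
  "dist_jt_predual x y = norm (x - y)"
definition sgn_jt_predual :: "jt_predual \<Rightarrow> jt_predual" where "sgn_jt_predual x = x /\<^sub>R norm x"
definition uniformity_jt_predual :: "(jt_predual \<times> jt_predual) filter" where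
  "uniformity_jt_predual = (INF e\<in>{0 <..}. principal {(x, y). dist x y < e})"
definition open_jt_predual :: "jt_predual set \<Rightarrow> bool" where
  "open_jt_predual U = (\<forall>x\<in>U. eventually (\<lambda>(x', y). x' = x \<longrightarrow> y \<in> U) uniformity)"

instance
proof
  fix x y :: jt_predual and a :: real
  show "(norm x = 0) = (x = 0)" by transfer simp
  show "norm (x + y) \<le> norm x + norm y" by transfer (rule norm_triangle_ineq)
  show "norm (a *\<^sub>R x) = \<bar>a\<bar> * norm x" by transfer simp
qed (simp_all only: dist_jt_predual_def sgn_jt_predual_def uniformity_jt_predual_def
    open_jt_predual_def)

end

definition slice :: "'a::real_normed_vector set \<Rightarrow> ('a \<Rightarrow>\<^sub>L real) \<Rightarrow> real \<Rightarrow> 'a set" where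
  "slice A \<phi> \<alpha> = {x \<in> A. blinfun_apply \<phi> x > (SUP y\<in>A. blinfun_apply \<phi> y) - \<alpha>}"

end

(* The slices are cut out by the coordinate vector e of the root.  If f has norm at most 1 and
   f(e) is close to 1, then comparing f(k e + y) with the norm of k e + y for large k shows that
   f(y) is, up to a small error, at most the supremum M(y) of the sums of y over the segments
   through the root.  For two such functionals f and g this gives
   f(y) - g(y) \<le> M(y) + M(-y) + error.  Two segments R, R' through the root differ by two disjoint
   (possibly empty) segments, so the difference of the sums of y over R and R' is at most
   sqrt 2 * norm y, whence M(y) + M(-y) \<le> sqrt 2 * norm y. *)
theory Submission
  imports Defs
begin

section \<open>The root vector and segments through the root\<close>

definition root_vector :: jt where
  "root_vector = Abs_jt (\<lambda>t. if t = (0, 0) then 1 else 0)"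

lemma jt_fun_root_vector: "jt_fun root_vector t = (if t = (0, 0) then 1 else 0)"
proof -
  have "finitely_nonzero (\<lambda>t. if t = (0, 0) then 1 else 0)"
    by (auto simp: finitely_nonzero_def dyadic_tree_def split: if_splits)
  then show ?thesis
    by (simp add: root_vector_def jt_fun_Abs_finitely_nonzero)
qed

lemma segment_finite: "segment S \<Longrightarrow> finite S"
  by (auto simp: segment_def)

text \<open>Each step down raises the level by one, and halving the index undoes it, so the head is
  the unique ancestor of \<open>t\<close> on its level. This is what separates chains that start at
  different vertices of one level.\<close>

lemma successively_offspring_head:
  assumes "successively offspring (b # ts)" "t \<in> set (b # ts)"
  shows "fst b \<le> fst t \<and> snd t div 2 ^ (fst t - fst b) = snd b"
  using assms
proof (induction ts arbitrary: b)
  case Nil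
  then show ?case by simp
next
  case (Cons c ts)
  show ?case
  proof (cases "t = b")
    case False
    with Cons have c: "fst c \<le> fst t" "snd t div 2 ^ (fst t - fst c) = snd c"
      and o: "offspring b c"
      by auto
    from o have "fst c = Suc (fst b)" "snd c div 2 = snd b"
      by (auto simp: offspring_def)
    moreover from this c have "fst t - fst b = Suc (fst t - fst c)" by simp
    ultimately show ?thesis using c
      by (metis Suc_leD div_mult2_eq power_Suc2)
  qed simp
qed

text \<open>Chains from a common vertex run together until they split, and then never meet again.
  What remains of the first chain is therefore one of its tails; the induction strips off the common
  heads.\<close>

lemma segment_diff:
  assumes "successively offspring (a # ts)" "successively offspring (a # us)"
    and "set (a # ts) \<subseteq> dyadic_tree"
  shows "set (a # ts) - set (a # us) = {} \<or> segment (set (a # ts) - set (a # us))"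
  using assms
proof (induction ts arbitrary: a us)
  case Nil
  then show ?case by simp
next
  case (Cons b ts)
  have ab: "fst b = Suc (fst a)" and bts: "successively offspring (b # ts)"
    using Cons.prems by (auto simp: offspring_def)
  have a: "a \<notin> set (b # ts)"
    using successively_offspring_head[OF bts, of a] ab by auto
  have seg: "segment (set (b # ts))"
    unfolding segment_def using bts Cons.prems by (intro exI[of _ "b # ts"]) auto
  show ?case
  proof (cases us)
    case Nil
    then have "set (a # b # ts) - set (a # us) = set (b # ts)" using a by auto
    with seg show ?thesis by simp
  next
    case (Cons c us')
    have ac: "fst c = Suc (fst a)" and cus: "successively offspring (c # us')"
      using Cons.prems Cons by (auto simp: offspring_def)
    show ?thesis
    proof (cases "b = c")
      case True
      have "set (a # b # ts) - set (a # us) = set (b # ts) - set (b # us')"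
        using a True Cons by auto
      then show ?thesis
        using Cons.IH[of b us'] bts cus Cons.prems True by simp
    next
      case False
      \<comment> \<open>Since \<open>b\<close> and \<open>c\<close> lie on one level, a common
        vertex would have both as its ancestor there, forcing \<open>b = c\<close>.\<close>
      have "set (b # ts) \<inter> set (c # us') = {}"
        using successively_offspring_head[OF bts] successively_offspring_head[OF cus]
          ab ac False by (metis disjoint_iff prod.expand)
      then have "set (a # b # ts) - set (a # us) = set (b # ts)"
        using a Cons by auto
      with seg show ?thesis by simp
    qed
  qed
qed

text \<open>No vertex lies above the root, so a chain that contains it must start there.\<close>

lemma root_segmentE:
  assumes "segment R" "(0, 0) \<in> R"
  obtains ts where "R = set ((0, 0) # ts)" "successively offspring ((0, 0) # ts)"
    "set ((0, 0) # ts) \<subseteq> dyadic_tree"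
proof -
  from assms obtain b ts where ts: "set (b # ts) \<subseteq> dyadic_tree" "successively offspring (b # ts)"
    "R = set (b # ts)" unfolding segment_def by (metis neq_Nil_conv)
  have "fst b = 0" "snd b = 0"
    using successively_offspring_head[OF ts(2), of "(0, 0)"] assms(2) ts(3) by auto
  then have "b = (0, 0)" by (simp add: prod_eq_iff)
  with ts show thesis by (intro that) auto
qed

lemma root_segment_diff:
  assumes "segment R" "(0, 0) \<in> R" "segment R'" "(0, 0) \<in> R'"
  shows "R - R' = {} \<or> segment (R - R')"
proof -
  from assms(1,2) obtain ts where ts: "R = set ((0, 0) # ts)"
    "successively offspring ((0, 0) # ts)" "set ((0, 0) # ts) \<subseteq> dyadic_tree"
    by (rule root_segmentE)
  from assms(3,4) obtain us where us: "R' = set ((0, 0) # us)"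
    "successively offspring ((0, 0) # us)" "set ((0, 0) # us) \<subseteq> dyadic_tree"
    by (rule root_segmentE)
  show ?thesis
    unfolding ts(1) us(1) by (rule segment_diff[OF ts(2) us(2) ts(3)])
qed

section \<open>Segment sums controlled by the norm\<close>

lemma segment_family_subset:
  assumes "segment_family F" "G \<subseteq> F"
  shows "segment_family G"
proof -
  have "finite G" using assms finite_subset by (auto simp: segment_family_def)
  moreover have "disjoint G" using assms pairwise_subset by (auto simp: segment_family_def)
  ultimately show ?thesis using assms by (auto simp: segment_family_def)
qed

lemma segment_family_unique:
  assumes "segment_family F" "S \<in> F" "S' \<in> F" "t \<in> S" "t \<in> S'"
  shows "S = S'"
  using assms by (auto simp: segment_family_def disjoint_def)

lemma sum_squares_le_norm:
  assumes "segment_family F"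
  shows "(\<Sum>S\<in>F. (sum (jt_fun y) S)\<^sup>2) \<le> (norm y)\<^sup>2"
proof -
  have "family_value F (jt_fun y) \<le> norm y"
    unfolding norm_jt_def by (rule family_value_le_norm[OF jt_bounded_jt_fun assms])
  then have "(family_value F (jt_fun y))\<^sup>2 \<le> (norm y)\<^sup>2"
    by (rule power_mono[OF _ family_value_nonneg])
  then show ?thesis by (simp add: family_value_def sum_nonneg)
qed

lemma norm_jt_leI:
  assumes "\<And>F. segment_family F \<Longrightarrow> (\<Sum>S\<in>F. (sum (jt_fun y) S)\<^sup>2) \<le> c\<^sup>2" "0 \<le> c"
  shows "norm y \<le> c"
  unfolding norm_jt_def
  using assms by (intro jt_norm_le) (simp add: family_value_def real_le_lsqrt sum_nonneg)

lemma abs_sum_segment_le: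
  assumes "segment S"
  shows "\<bar>sum (jt_fun y) S\<bar> \<le> norm y"
  using sum_squares_le_norm[of "{S}" y] assms
  by (simp add: segment_family_def abs_le_square_iff[of _ "norm y", simplified])

lemma root_segments_sum_diff_le:
  assumes "segment R" "(0, 0) \<in> R" "segment R'" "(0, 0) \<in> R'"
  shows "sum (jt_fun y) R - sum (jt_fun y) R' \<le> sqrt 2 * norm y"
proof -
  define D where "D = R - R'"
  define D' where "D' = R' - R"
  let ?u = "sum (jt_fun y) D" and ?v = "sum (jt_fun y) D'"
  have fin: "finite R" "finite R'" using assms segment_finite by auto
  have split: "sum (jt_fun y) R - sum (jt_fun y) R' = ?u - ?v"
    using sum.Int_Diff[OF fin(1), of "jt_fun y" R'] sum.Int_Diff[OF fin(2), of "jt_fun y" R]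
    by (simp add: D_def D'_def Int_commute)
  have D: "D = {} \<or> segment D" "D' = {} \<or> segment D'"
    unfolding D_def D'_def using root_segment_diff assms by auto
  have disj: "D \<inter> D' = {}" by (auto simp: D_def D'_def)
  \<comment> \<open>Segments are non-empty, so an empty difference has to leave the family; its sum
    is 0. The set \<open>{D, D'}\<close> collapses only when both differences are empty, because
    they are disjoint.\<close>
  have "?u\<^sup>2 + ?v\<^sup>2 = (\<Sum>S\<in>{D, D'} - {{}}. (sum (jt_fun y) S)\<^sup>2)"
  proof (cases "D = D'")
    case True
    with disj have "D = {}" "D' = {}" by auto
    then show ?thesis by simp
  next
    case False
    then have "?u\<^sup>2 + ?v\<^sup>2 = (\<Sum>S\<in>{D, D'}. (sum (jt_fun y) S)\<^sup>2)" by simp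
    also have "\<dots> = (\<Sum>S\<in>{D, D'} - {{}}. (sum (jt_fun y) S)\<^sup>2)"
      by (intro sum.mono_neutral_right) auto
    finally show ?thesis .
  qed
  also have "\<dots> \<le> (norm y)\<^sup>2"
    using D disj by (intro sum_squares_le_norm) (auto simp: segment_family_def disjoint_def)
  finally have "?u\<^sup>2 + ?v\<^sup>2 \<le> (norm y)\<^sup>2" .
  \<comment> \<open>The factor 2 here is the source of the constant sqrt 2.\<close>
  moreover have "(?u - ?v)\<^sup>2 \<le> 2 * (?u\<^sup>2 + ?v\<^sup>2)"
    using zero_le_power2[of "?u + ?v"] by (simp add: power2_eq_square algebra_simps)
  ultimately have "(?u - ?v)\<^sup>2 \<le> (sqrt 2 * norm y)\<^sup>2"
    by (simp add: power_mult_distrib)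
  then have "?u - ?v \<le> sqrt 2 * norm y" by (rule power2_le_imp_le) simp
  with split show ?thesis by simp
qed

section \<open>Norms of k e + y, and functionals that almost norm e\<close>

lemma sum_root_vector:
  assumes "finite S"
  shows "sum (jt_fun (k *\<^sub>R root_vector + y)) S
    = (if (0, 0) \<in> S then k else 0) + sum (jt_fun y) S"
  using assms
  by (simp add: jt_fun_add jt_fun_scaleR jt_fun_root_vector sum.distrib flip: sum_distrib_left)

text \<open>By disjointness at most one member of a family contains the root; it contributes at most
  (k + m)^2. The other members do not see k e and together contribute at most (norm y)^2.\<close>

lemma norm_root_vector_add_le:
  assumes y: "norm y \<le> 1" and k: "k \<ge> 1"
    and m: "\<And>R. segment R \<Longrightarrow> (0, 0) \<in> R \<Longrightarrow> sum (jt_fun y) R \<le> m"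
  shows "norm (k *\<^sub>R root_vector + y) \<le> sqrt ((k + m)\<^sup>2 + 1)"
proof (rule norm_jt_leI)
  fix F assume F: "segment_family F"
  let ?s = "\<lambda>S. (sum (jt_fun (k *\<^sub>R root_vector + y)) S)\<^sup>2"
  have le1: "(\<Sum>S\<in>G. (sum (jt_fun y) S)\<^sup>2) \<le> 1" if "segment_family G" for G
    using sum_squares_le_norm[OF that, of y] power_mono[OF y, of 2] by simp
  have finF: "finite F" and seg: "\<And>S. S \<in> F \<Longrightarrow> segment S"
    using F by (auto simp: segment_family_def)
  have off: "(\<Sum>S\<in>G. ?s S) \<le> 1" if G: "G \<subseteq> F" "\<And>S. S \<in> G \<Longrightarrow> (0, 0) \<notin> S" for G
  proof -
    have "(\<Sum>S\<in>G. ?s S) = (\<Sum>S\<in>G. (sum (jt_fun y) S)\<^sup>2)"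
      using G seg by (intro sum.cong) (auto simp: sum_root_vector segment_finite subset_iff)
    moreover have "segment_family G"
      by (rule segment_family_subset[OF F G(1)])
    ultimately show ?thesis using le1 by simp
  qed
  have "(\<Sum>S\<in>F. ?s S) \<le> (k + m)\<^sup>2 + 1"
  proof (cases "\<exists>R\<in>F. (0, 0) \<in> R")
    case False
    then have "(\<Sum>S\<in>F. ?s S) \<le> 1" by (intro off) auto
    then show ?thesis by (simp add: add_increasing)
  next
    case True
    then obtain R where R: "R \<in> F" "(0, 0) \<in> R" by blast
    have "(\<Sum>S\<in>F. ?s S) = ?s R + (\<Sum>S\<in>F - {R}. ?s S)"
      by (rule sum.remove[OF finF R(1)])
    moreover have "(\<Sum>S\<in>F - {R}. ?s S) \<le> 1"
      using F R by (intro off) (auto simp: segment_family_def disjoint_def)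
    \<comment> \<open>Squaring is monotone only on nonnegative numbers: the sum of \<open>y\<close>
      over \<open>R\<close> is at least -1, and k \<ge> 1 compensates for it.\<close>
    moreover have "?s R \<le> (k + m)\<^sup>2"
    proof -
      have "sum (jt_fun (k *\<^sub>R root_vector + y)) R = k + sum (jt_fun y) R"
        using R seg by (simp add: sum_root_vector segment_finite)
      moreover have "sum (jt_fun y) R \<ge> -1" "sum (jt_fun y) R \<le> m"
        using abs_sum_segment_le[of R y] y m R seg by auto
      ultimately show ?thesis using k by (simp add: power_mono)
    qed
    ultimately show ?thesis by linarith
  qed
  then show "(\<Sum>S\<in>F. ?s S) \<le> (sqrt ((k + m)\<^sup>2 + 1))\<^sup>2" by simp
qed simp

text \<open>The sum of squares over a family counts its members through the root, and disjointness
  allows at most one.\<close>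

lemma norm_root_vector_le: "norm root_vector \<le> 1"
proof (rule norm_jt_leI)
  fix F assume F: "segment_family F"
  have s: "(sum (jt_fun root_vector) S)\<^sup>2 = (if (0, 0) \<in> S then 1 else 0)" if "S \<in> F" for S
    using F that sum_root_vector[of S 1 0]
    by (simp add: segment_family_def segment_finite jt_fun_zero)
  have "finite F" using F by (simp add: segment_family_def)
  then have "(\<Sum>S\<in>F. (sum (jt_fun root_vector) S)\<^sup>2) = real (card {S \<in> F. (0, 0) \<in> S})"
    by (simp add: s sum.If_cases Int_def)
  moreover have "card {S \<in> F. (0, 0) \<in> S} \<le> Suc 0"
  proof (subst card_le_Suc0_iff_eq)
    show "finite {S \<in> F. (0, 0) \<in> S}" using \<open>finite F\<close> by simp
    show "\<forall>S\<in>{S \<in> F. (0, 0) \<in> S}. \<forall>S'\<in>{S \<in> F. (0, 0) \<in> S}. S = S'"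
      using segment_family_unique[OF F] by auto
  qed
  ultimately show "(\<Sum>S\<in>F. (sum (jt_fun root_vector) S)\<^sup>2) \<le> 1\<^sup>2" by simp
qed simp

text \<open>Evaluate \<open>f\<close> at (k + 1) e + y. The value is at least (k + 1)(1 - \<alpha>)
  + f(y), while the norm is at most sqrt((k + 1 + m)^2 + 1), which exceeds k + 1 + m by at most
  1/(2k).\<close>

lemma functional_le_root_segments:
  fixes f :: "jt \<Rightarrow>\<^sub>L real"
  assumes f: "norm f \<le> 1" and fe: "f root_vector \<ge> 1 - \<alpha>" and y: "norm y \<le> 1" and k: "k > 0"
    and m: "\<And>R. segment R \<Longrightarrow> (0, 0) \<in> R \<Longrightarrow> sum (jt_fun y) R \<le> m"
  shows "f y \<le> m + (k + 1) * \<alpha> + 1 / (2 * k)"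
proof -
  \<comment> \<open>The one-point segment at the root forces m \<ge> -1, so k + 1 + m \<ge>
    k.\<close>
  have "segment {(0, 0)}" by (rule segment_singleton) (simp add: dyadic_tree_def)
  from m[OF this] abs_sum_segment_le[OF this, of y] y have m1: "m \<ge> -1" by simp
  have "(k + 1) * (1 - \<alpha>) + f y \<le> (k + 1) * f root_vector + f y"
    using fe k by (intro add_right_mono mult_left_mono) auto
  also have "\<dots> = f ((k + 1) *\<^sub>R root_vector + y)"
    by (simp add: blinfun.bilinear_simps)
  also have "\<dots> \<le> norm f * norm ((k + 1) *\<^sub>R root_vector + y)"
    using norm_blinfun[of f "(k + 1) *\<^sub>R root_vector + y"] by simp
  also have "\<dots> \<le> norm ((k + 1) *\<^sub>R root_vector + y)"
    using f by (intro mult_left_le_one_le) auto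
  also have "\<dots> \<le> sqrt ((k + 1 + m)\<^sup>2 + 1)"
    using k by (intro norm_root_vector_add_le y m) auto
  also have "\<dots> \<le> k + 1 + m + 1 / (2 * k)"
  proof (rule real_le_lsqrt)
    \<comment> \<open>This is the cross term of the square below; it alone absorbs the summand 1
      under the root.\<close>
    have "1 \<le> (k + 1 + m) * (1 / k)" using m1 k by (simp add: field_simps)
    moreover have "(k + 1 + m + 1 / (2 * k))\<^sup>2
        = (k + 1 + m)\<^sup>2 + (k + 1 + m) * (1 / k) + (1 / (2 * k))\<^sup>2"
      using k by (simp add: power2_sum) (simp add: field_simps)
    ultimately show "(k + 1 + m)\<^sup>2 + 1 \<le> (k + 1 + m + 1 / (2 * k))\<^sup>2"
      by (smt (verit) zero_le_power2)
    show "0 \<le> k + 1 + m + 1 / (2 * k)" using m1 k by simp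
  qed
  finally show ?thesis by (simp add: algebra_simps)
qed

lemma functional_diff_le:
  fixes f g :: "jt \<Rightarrow>\<^sub>L real"
  assumes f: "norm f \<le> 1" "f root_vector \<ge> 1 - \<alpha>" and g: "norm g \<le> 1" "g root_vector \<ge> 1 - \<alpha>"
    and y: "norm y \<le> 1" and k: "k > 0"
  shows "f y - g y \<le> sqrt 2 + 2 * ((k + 1) * \<alpha> + 1 / (2 * k))"
proof -
  let ?c = "(k + 1) * \<alpha> + 1 / (2 * k)"
  \<comment> \<open>The suprema M(y) and M(-y) are replaced by two nested bounds. For a fixed
    \<open>R\<close>, the estimate for \<open>g\<close> at -y bounds the sum of \<open>y\<close>
    over \<open>R\<close>; this bound, uniform in \<open>R\<close>, then serves as m for
    \<open>f\<close>.\<close>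
  have "f y \<le> (sqrt 2 + ?c + g y) + (k + 1) * \<alpha> + 1 / (2 * k)"
  proof (rule functional_le_root_segments[OF f y k])
    fix R :: "(nat \<times> nat) set" assume R: "segment R" "(0, 0) \<in> R"
    have "g (- y) \<le> (sqrt 2 - sum (jt_fun y) R) + (k + 1) * \<alpha> + 1 / (2 * k)"
    proof (rule functional_le_root_segments[OF g _ k])
      fix R' :: "(nat \<times> nat) set" assume R': "segment R'" "(0, 0) \<in> R'"
      have "sqrt 2 * norm y \<le> sqrt 2" using y by simp
      with root_segments_sum_diff_le[OF R R', of y]
      have "- sum (jt_fun y) R' \<le> sqrt 2 - sum (jt_fun y) R" by linarith
      then show "sum (jt_fun (- y)) R' \<le> sqrt 2 - sum (jt_fun y) R"
        by (simp add: jt_fun_uminus sum_negf)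
    qed (use y in simp)
    then show "sum (jt_fun y) R \<le> sqrt 2 + ?c + g y"
      unfolding blinfun.minus_right by linarith
  qed
  then show ?thesis by (simp add: algebra_simps)
qed

text \<open>A one-sided bound suffices because the unit ball is symmetric.\<close>

lemma norm_blinfun_le_unit_ball:
  fixes h :: "'a::real_normed_vector \<Rightarrow>\<^sub>L real"
  assumes "\<And>y. norm y \<le> 1 \<Longrightarrow> h y \<le> c" "0 \<le> c"
  shows "norm h \<le> c"
proof (rule norm_blinfun_bound[OF assms(2)])
  fix y
  have *: "h z \<le> c * norm z" for z
  proof (cases "z = 0")
    case False
    then have "h (z /\<^sub>R norm z) \<le> c" by (intro assms(1)) simp
    with False show ?thesis by (simp add: blinfun.scaleR_right field_simps)
  qed (simp add: blinfun.zero_right)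
  from *[of y] *[of "- y"] show "norm (h y) \<le> c * norm y"
    by (simp add: blinfun.minus_right)
qed

section \<open>Slices of the unit ball of B cut out by e\<close>

definition root_eval :: "jt_predual \<Rightarrow>\<^sub>L real" where
  "root_eval = Blinfun (\<lambda>f. jt_functional f root_vector)"

lemma abs_apply_root_vector_le: "\<bar>jt_functional f root_vector\<bar> \<le> norm f"
proof -
  have "\<bar>jt_functional f root_vector\<bar> \<le> norm (jt_functional f) * norm root_vector"
    using norm_blinfun[of "jt_functional f" root_vector] by simp
  also have "\<dots> \<le> norm f"
    using norm_root_vector_le by (simp add: norm_jt_predual.rep_eq mult_left_le)
  finally show ?thesis .
qed

lemma root_eval_apply: "root_eval f = jt_functional f root_vector"
proof -
  have "bounded_linear (\<lambda>f. jt_functional f root_vector)"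
    by (rule bounded_linear_intro[where K = 1])
      (simp_all add: plus_jt_predual.rep_eq scaleR_jt_predual.rep_eq blinfun.bilinear_simps
        abs_apply_root_vector_le)
  then show ?thesis by (simp add: root_eval_def bounded_linear_Blinfun_apply)
qed

text \<open>The coordinate functional of the root lies in the unit ball of B and equals 1 at e.
  Hence every \<open>f\<close> in the slice of width \<alpha> satisfies f(e) > 1 - \<alpha>.\<close>

lemma SUP_root_eval_ge: "1 \<le> (SUP f\<in>cball 0 1. root_eval f)"
proof -
  define f where "f = Abs_jt_predual (jt_coord (0, 0))"
  have "jt_coord (0, 0) \<in> closure (span (jt_coord ` dyadic_tree))"
    using closure_subset span_superset by (force simp: dyadic_tree_def)
  then have f: "jt_functional f = jt_coord (0, 0)"
    by (simp add: f_def Abs_jt_predual_inverse)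
  have "norm f \<le> 1"
    unfolding norm_jt_predual.rep_eq f
    by (rule norm_blinfun_bound) (simp_all add: jt_coord.rep_eq abs_jt_fun_le)
  moreover have "root_eval f = 1"
    by (simp add: root_eval_apply f jt_coord.rep_eq jt_fun_root_vector)
  moreover have "bdd_above (root_eval ` cball 0 1)"
  proof (intro bdd_aboveI[of _ 1], clarsimp simp: root_eval_apply)
    fix g :: jt_predual assume "norm g \<le> 1"
    with abs_apply_root_vector_le[of g] show "jt_functional g root_vector \<le> 1" by linarith
  qed
  ultimately show ?thesis
    by (metis cSUP_upper mem_cball_0)
qed

lemma diameter_slice_root_eval_le:
  assumes "\<epsilon> > 0"
  shows "\<exists>\<alpha>>0. diameter (slice (cball 0 1) root_eval \<alpha>) \<le> sqrt 2 + \<epsilon>"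
proof -
  \<comment> \<open>With these choices (k + 1) \<alpha> and 1/(2k) both equal \<epsilon>/4, so the
    error in \<open>functional_diff_le\<close> is exactly \<epsilon>.\<close>
  define k where "k = 2 / \<epsilon>"
  define \<alpha> where "\<alpha> = \<epsilon> / (4 * (k + 1))"
  have k: "k > 0" and \<alpha>: "\<alpha> > 0" using assms by (simp_all add: k_def \<alpha>_def add_pos_pos)
  have "(k + 1) * \<alpha> = \<epsilon> / 4" using k by (simp add: \<alpha>_def divide_simps)
  moreover have "1 / (2 * k) = \<epsilon> / 4" using assms by (simp add: k_def)
  ultimately have err: "2 * ((k + 1) * \<alpha> + 1 / (2 * k)) = \<epsilon>" by simp
  have "diameter (slice (cball 0 1) root_eval \<alpha>) \<le> sqrt 2 + \<epsilon>"
  proof (rule diameter_le)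
    fix f g assume fg: "f \<in> slice (cball 0 1) root_eval \<alpha>" "g \<in> slice (cball 0 1) root_eval \<alpha>"
    have h: "norm (jt_functional h) \<le> 1 \<and> jt_functional h root_vector \<ge> 1 - \<alpha>"
      if "h \<in> slice (cball 0 1) root_eval \<alpha>" for h
      using that SUP_root_eval_ge
      by (auto simp: slice_def root_eval_apply norm_jt_predual.rep_eq)
    have "norm (jt_functional f - jt_functional g) \<le> sqrt 2 + \<epsilon>"
    proof (rule norm_blinfun_le_unit_ball)
      fix y :: jt assume "norm y \<le> 1"
      from functional_diff_le[OF _ _ _ _ this k, of "jt_functional f" \<alpha> "jt_functional g"] h fg err
      show "(jt_functional f - jt_functional g) y \<le> sqrt 2 + \<epsilon>"
        by (simp add: blinfun.diff_left)
    qed (use assms in simp)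
    then show "norm (f - g) \<le> sqrt 2 + \<epsilon>"
      by (simp add: norm_jt_predual.rep_eq minus_jt_predual.rep_eq)
  qed (use assms in simp)
  with \<alpha> show ?thesis by blast
qed

theorem mainTheorem3:
  shows "Inf {diameter (slice (cball (0 :: jt_predual) 1) \<phi> \<alpha>) | \<phi> \<alpha>. \<alpha> > 0} \<le> sqrt 2"
proof (rule field_le_epsilon)
  fix \<epsilon> :: real assume "\<epsilon> > 0"
  then obtain \<alpha> where \<alpha>: "\<alpha> > 0"
    "diameter (slice (cball 0 1) root_eval \<alpha>) \<le> sqrt 2 + \<epsilon>"
    using diameter_slice_root_eval_le by blast
  \<comment> \<open>Boundedness of the slices makes their diameters nonnegative, so the set of
    diameters is bounded below and its real \<open>Inf\<close> is a genuine lower bound.\<close>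
  have "bounded (slice (cball 0 1) \<phi> \<beta>)" for \<phi> :: "jt_predual \<Rightarrow>\<^sub>L real" and \<beta>
    by (rule bounded_subset[OF bounded_cball[of 0 1]]) (auto simp: slice_def)
  then have "bdd_below {diameter (slice (cball (0 :: jt_predual) 1) \<phi> \<alpha>) | \<phi> \<alpha>. \<alpha> > 0}"
    by (intro bdd_belowI[of _ 0]) (auto intro: diameter_ge_0)
  then have "Inf {diameter (slice (cball (0 :: jt_predual) 1) \<phi> \<alpha>) | \<phi> \<alpha>. \<alpha> > 0}
      \<le> diameter (slice (cball 0 1) root_eval \<alpha>)"
    using \<alpha>(1) by (intro cInf_lower) auto
  with \<alpha>(2) show "Inf {diameter (slice (cball (0 :: jt_predual) 1) \<phi> \<alpha>) | \<phi> \<alpha>. \<alpha> > 0}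
      \<le> sqrt 2 + \<epsilon>" by linarith
qed

end
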